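(* Let $G$ be a finite simple graph with maximum degree $\Delta\ge 3$. If no connected component of $G$ is isomorphic to the complete bipartite graph $K_{\Delta,\Delta}$, then $\chi'_{ss}(G)\le \Delta^2-1$.
   Context: All graphs are finite, simple and undirected. For $M\subseteq E(G)$, $G[V(M)]$ denotes the subgraph of $G$ induced by the set of endvertices of edges of $M$. A set $M\subseteq E(G)$ is a semistrong matching if every edge of $M$ is incident with a vertex that has degree $1$ in $G[V(M)]$. For a positive integer $k$, a semistrong $k$-edge-coloring of $G$ is an assignment of at most $k$ colors to the edges of $G$ in which every color class is a semistrong matching. The semistrong chromatic index $\chi'_{ss}(G)$ is the least $k$ such that $G$ has a semistrong $k$-edge-coloring. $K_{i,j}$ is the complete bipartite graph with parts of sizes $i$ and $j$. *)

theory Defs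
  imports Main
begin

definition simple_graph :: "'a set \<Rightarrow> 'a set set \<Rightarrow> bool" where
  "simple_graph V E \<longleftrightarrow> finite V \<and> (\<forall>e\<in>E. e \<subseteq> V \<and> card e = 2)"

definition degree :: "'a set set \<Rightarrow> 'a \<Rightarrow> nat" where
  "degree E v = card {e\<in>E. v \<in> e}"

definition max_degree :: "'a set \<Rightarrow> 'a set set \<Rightarrow> nat" where
  "max_degree V E = Max (insert 0 (degree E ` V))"

definition induced_edges :: "'a set set \<Rightarrow> 'a set \<Rightarrow> 'a set set" where
  "induced_edges E S = {e\<in>E. e \<subseteq> S}"

definition semistrong_matching :: "'a set set \<Rightarrow> 'a set set \<Rightarrow> bool" where
  "semistrong_matching E M \<longleftrightarrow> M \<subseteq> E \<and>
     (\<forall>e\<in>M. \<exists>v\<in>e. degree (induced_edges E (\<Union>M)) v = 1)"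

definition semistrong_coloring :: "'a set set \<Rightarrow> nat \<Rightarrow> ('a set \<Rightarrow> nat) \<Rightarrow> bool" where
  "semistrong_coloring E k c \<longleftrightarrow> c ` E \<subseteq> {..<k} \<and>
     (\<forall>i. semistrong_matching E {e\<in>E. c e = i})"

definition semistrong_chromatic_index :: "'a set set \<Rightarrow> nat" where
  "semistrong_chromatic_index E = (LEAST k. \<exists>c. semistrong_coloring E k c)"

inductive reachable :: "'a set set \<Rightarrow> 'a \<Rightarrow> 'a \<Rightarrow> bool" for E where
  refl: "reachable E v v"
| step: "reachable E u v \<Longrightarrow> {v, w} \<in> E \<Longrightarrow> reachable E u w"

definition components :: "'a set \<Rightarrow> 'a set set \<Rightarrow> 'a set set" where
  "components V E = {{w\<in>V. reachable E v w} | v. v \<in> V}"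

definition iso_complete_bipartite :: "'a set \<Rightarrow> 'a set set \<Rightarrow> nat \<Rightarrow> bool" where
  "iso_complete_bipartite C F n \<longleftrightarrow>
     (\<exists>A B. A \<inter> B = {} \<and> A \<union> B = C \<and> card A = n \<and> card B = n \<and>
            F = {{a, b} | a b. a \<in> A \<and> b \<in> B})"

end

theory Submission
  imports Defs
begin

text \<open>
  Let \<^term>\<open>D\<close> be the maximum degree. Between two edges count the adjacent pairs of ends as links:
  adjacent edges have at least two, and an edge has at most \<^term>\<open>2 * D^2 - 2\<close> links to other edges.
  Choose a coloring with \<^term>\<open>D^2 - 1\<close> colors and as few monochromatic links as possible.
  If every edge has at most one link within its color, every class is a semistrong matching.
  Otherwise some edge is tight: by minimality it has exactly two links in every color, so recoloring
  it keeps the coloring minimal, and giving it the color of an adjacent edge makes that edge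
  tight. Tightness thus spreads over a whole component, which must be \<^term>\<open>D\<close>-regular and
  triangle-free. Moreover the edges meeting the neighborhood of an end of a tight edge
  have distinct colors, the tight edge excepted. For an edge \<^term>\<open>e\<close> that avoids the neighborhood of
  a vertex \<^term>\<open>p\<close>, shifting tightness from \<^term>\<open>e\<close> towards \<^term>\<open>p\<close> shows that the part of the graph
  reachable from \<^term>\<open>e\<close> without crossing that neighborhood is joined to it by at most two edges.
  Since \<^term>\<open>D \<ge> (3::nat)\<close>, some neighbor \<^term>\<open>t\<close> of \<^term>\<open>p\<close> is missed by these, and replacing \<^term>\<open>p\<close> by
  \<^term>\<open>t\<close> enlarges the reachable part, which cannot go on forever. So in the component every edge
  meets every neighborhood, and the component is complete bipartite.
\<close>

text \<open>Edges are unordered, so closure of \<open>U\<close> also carries membership backwards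
  along an edge; this is what gives an equivalence.\<close>

lemma reachable_closed_set:
  assumes "reachable E u w" and "\<And>x y. {x, y} \<in> E \<Longrightarrow> x \<in> U \<Longrightarrow> y \<in> U"
  shows "u \<in> U \<longleftrightarrow> w \<in> U"
  using assms
proof induction
  case (step u v w)
  have "{w, v} \<in> E" using step.hyps(2) by (simp add: insert_commute)
  then show ?case using step by blast
qed simp

section \<open>Neighborhoods in a graph of bounded degree\<close>

locale bounded_graph =
  fixes V :: "'a set" and E :: "'a set set" and D :: nat
  assumes simple: "simple_graph V E"
    and degree_le_V: "\<And>v. v \<in> V \<Longrightarrow> degree E v \<le> D"
    and D_ge_3: "D \<ge> 3"
begin

lemma finite_V: "finite V"
  using simple by (simp add: simple_graph_def)

lemma edge_subset: "e \<in> E \<Longrightarrow> e \<subseteq> V"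
  using simple by (simp add: simple_graph_def)

lemma edge_card: "e \<in> E \<Longrightarrow> card e = 2"
  using simple by (simp add: simple_graph_def)

lemma finite_E: "finite E"
  using finite_V edge_subset by (meson PowI finite_Pow_iff finite_subset subsetI)

lemma finite_edge: "e \<in> E \<Longrightarrow> finite e"
  using edge_subset finite_V finite_subset by blast

lemma edge_other_end:
  assumes "e \<in> E" "u \<in> e"
  obtains v where "e = {u, v}" "u \<noteq> v"
proof -
  obtain x y where "e = {x, y}" "x \<noteq> y"
    using edge_card[OF assms(1)] by (auto simp: card_2_iff)
  with assms(2) that show ?thesis by (auto simp: insert_commute)
qed

lemma no_loop: "{u, v} \<in> E \<Longrightarrow> u \<noteq> v"
  using edge_card by force

lemma degree_le: "degree E v \<le> D"
proof (cases "v \<in> V")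
  case False
  then have "{e\<in>E. v \<in> e} = {}" using edge_subset by blast
  then show ?thesis unfolding degree_def by (simp only: card.empty)
qed (rule degree_le_V)

definition nbs :: "'a \<Rightarrow> 'a set" where
  "nbs v = {w. {v, w} \<in> E}"

lemma nbs_sym: "w \<in> nbs v \<longleftrightarrow> v \<in> nbs w"
  by (simp add: nbs_def insert_commute)

lemma nbs_subset: "nbs v \<subseteq> V"
  using edge_subset by (auto simp: nbs_def)

lemma finite_nbs: "finite (nbs v)"
  using nbs_subset finite_V finite_subset by blast

lemma card_nbs: "card (nbs v) = degree E v"
proof -
  have "bij_betw (\<lambda>w. {v, w}) (nbs v) {e\<in>E. v \<in> e}"
    unfolding bij_betw_def
  proof
    show "inj_on (\<lambda>w. {v, w}) (nbs v)"
      by (auto simp: inj_on_def doubleton_eq_iff)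
    show "(\<lambda>w. {v, w}) ` nbs v = {e\<in>E. v \<in> e}"
    proof (intro equalityI subsetI)
      fix e assume "e \<in> {e\<in>E. v \<in> e}"
      then obtain w where "e \<in> E" "e = {v, w}" using edge_other_end by blast
      then show "e \<in> (\<lambda>w. {v, w}) ` nbs v" by (auto simp: nbs_def)
    qed (auto simp: nbs_def)
  qed
  then show ?thesis by (simp add: degree_def bij_betw_same_card)
qed

section \<open>Counting links between edges\<close>

text \<open>The pairs are ordered and may repeat a vertex, so a shared end counts as often as it
  should: an edge has two links with itself.\<close>

definition link :: "'a set \<Rightarrow> 'a set \<Rightarrow> nat" where
  "link e f = card {p \<in> e \<times> f. {fst p, snd p} \<in> E}"

lemma link_sym: "link e f = link f e"
proof -
  have "bij_betw prod.swap {p \<in> e \<times> f. {fst p, snd p} \<in> E} {p \<in> f \<times> e. {fst p, snd p} \<in> E}"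
    by (rule bij_betw_byWitness[of _ prod.swap]) (auto simp: insert_commute)
  then show ?thesis by (simp add: link_def bij_betw_same_card)
qed

lemma card_le_link:
  assumes "e \<in> E" "f \<in> E" "P \<subseteq> e \<times> f" "\<And>a b. (a, b) \<in> P \<Longrightarrow> {a, b} \<in> E"
  shows "card P \<le> link e f"
  unfolding link_def
proof (rule card_mono)
  show "finite {p \<in> e \<times> f. {fst p, snd p} \<in> E}"
    using assms(1,2) finite_edge by auto
  show "P \<subseteq> {p \<in> e \<times> f. {fst p, snd p} \<in> E}"
    using assms(3,4) by auto
qed

lemma link_pos:
  assumes "e \<in> E" "f \<in> E" "a \<in> e" "b \<in> f" "b \<in> nbs a"
  shows "1 \<le> link e f"
  using card_le_link[OF assms(1,2), of "{(a, b)}"] assms(3-5) by (auto simp: nbs_def)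

lemma link_adjacent:
  assumes "e \<in> E" "f \<in> E" "u \<in> e" "u \<in> f"
  shows "2 \<le> link e f"
proof -
  obtain v where v: "e = {u, v}" "u \<noteq> v" using edge_other_end assms(1,3) .
  obtain x where x: "f = {u, x}" "u \<noteq> x" using edge_other_end assms(2,4) .
  have "card {(u, x), (v, u)} \<le> link e f"
    using assms v x by (intro card_le_link) (auto simp: insert_commute)
  then show ?thesis using v(2) by simp
qed

lemma link_triangle:
  assumes "{u, v} \<in> E" "{v, w} \<in> E" "{u, w} \<in> E"
  shows "3 \<le> link {u, v} {v, w}"
proof -
  have "card {(u, v), (v, w), (u, w)} \<le> link {u, v} {v, w}"
    using assms by (intro card_le_link) (auto simp: insert_commute)
  then show ?thesis using no_loop[OF assms(1)] no_loop[OF assms(2)] by auto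
qed

text \<open>The number of walks of length two from \<open>a\<close>, those returning to
  \<open>a\<close> included.\<close>

definition walks :: "'a \<Rightarrow> nat" where
  "walks a = (\<Sum>b\<in>nbs a. degree E b)"

lemma walks_le: "walks a \<le> card (nbs a) * D"
  unfolding walks_def using sum_bounded_above[of "nbs a" "degree E" D] degree_le by simp

lemma walks_le_square: "walks a \<le> D^2"
proof -
  have "card (nbs a) * D \<le> D * D"
    using degree_le[of a] by (simp only: card_nbs mult_le_mono1)
  then show ?thesis using walks_le[of a] unfolding power2_eq_square by (rule order_trans[rotated])
qed

text \<open>Double counting: a link from \<open>a\<close> in \<open>e\<close> to \<open>b\<close> in
  \<open>f\<close> is a step to \<open>b\<close> followed by the choice of an edge \<open>f\<close>
  at \<open>b\<close>.\<close>

lemma sum_link: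
  assumes "e \<in> E"
  shows "(\<Sum>f\<in>E. link e f) = (\<Sum>a\<in>e. walks a)"
proof -
  have "link e f = (\<Sum>a\<in>e. \<Sum>b\<in>nbs a. of_bool (b \<in> f))" if "f \<in> E" for f
  proof -
    have "{p \<in> e \<times> f. {fst p, snd p} \<in> E} = (SIGMA a:e. nbs a \<inter> f)"
      by (auto simp: nbs_def)
    then have "link e f = (\<Sum>a\<in>e. card (nbs a \<inter> f))"
      unfolding link_def using assms finite_edge finite_nbs by (simp add: card_SigmaI)
    also have "\<dots> = (\<Sum>a\<in>e. \<Sum>b\<in>nbs a. of_bool (b \<in> f))"
      using finite_nbs by (simp add: sum.If_cases of_bool_def Int_def)
    finally show ?thesis .
  qed
  then have "(\<Sum>f\<in>E. link e f) = (\<Sum>f\<in>E. \<Sum>a\<in>e. \<Sum>b\<in>nbs a. of_bool (b \<in> f))"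
    by simp
  also have "\<dots> = (\<Sum>a\<in>e. \<Sum>f\<in>E. \<Sum>b\<in>nbs a. of_bool (b \<in> f))"
    by (rule sum.swap)
  also have "\<dots> = (\<Sum>a\<in>e. \<Sum>b\<in>nbs a. \<Sum>f\<in>E. of_bool (b \<in> f))"
    by (rule sum.cong[OF HOL.refl sum.swap])
  also have "\<dots> = (\<Sum>a\<in>e. walks a)"
    using finite_E by (simp add: walks_def degree_def sum.If_cases of_bool_def Int_def)
  finally show ?thesis .
qed

definition k :: nat where "k = D^2 - 1"

lemma k_ge: "k \<ge> 8" and k_Suc: "Suc k = D^2"
proof -
  have "D^2 \<ge> 3^2" using D_ge_3 power_mono by blast
  then show "k \<ge> 8" "Suc k = D^2" by (auto simp: k_def)
qed

text \<open>The walks also count the links of \<open>e\<close> with itself. Removing these lowers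
  the bound from \<open>2 * D^2\<close> to \<open>2 * k\<close>, an average of two per
  color.\<close>

lemma sum_link_others:
  assumes "e \<in> E"
  shows "(\<Sum>f\<in>E - {e}. link e f) + 2 \<le> (\<Sum>a\<in>e. walks a)"
proof -
  have "2 \<le> link e e"
    using edge_card[OF assms] link_adjacent[OF assms assms]
    by (metis all_not_in_conv card.empty zero_neq_numeral)
  then show ?thesis
    using sum_link[OF assms] sum.remove[OF finite_E assms, of "link e"] by simp
qed

lemma sum_walks_le: "e \<in> E \<Longrightarrow> (\<Sum>a\<in>e. walks a) \<le> 2 * D^2"
  using sum_bounded_above[of e walks "D^2"] walks_le_square edge_card by simp

section \<open>Colorings of minimal cost and tight edges\<close>

definition colouring :: "('a set \<Rightarrow> nat) \<Rightarrow> bool" where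
  "colouring c \<longleftrightarrow> (\<forall>e\<in>E. c e < k)"

definition seen :: "('a set \<Rightarrow> nat) \<Rightarrow> 'a set \<Rightarrow> nat \<Rightarrow> nat" where
  "seen c e j = (\<Sum>f \<in> {f \<in> E - {e}. c f = j}. link e f)"

text \<open>Each monochromatic pair is counted from both of its edges, hence the factors 2
  below.\<close>

definition cost :: "('a set \<Rightarrow> nat) \<Rightarrow> nat" where
  "cost c = (\<Sum>e\<in>E. seen c e (c e))"

definition minimal :: "('a set \<Rightarrow> nat) \<Rightarrow> bool" where
  "minimal c \<longleftrightarrow> colouring c \<and> (\<forall>c'. colouring c' \<longrightarrow> cost c \<le> cost c')"

definition tight :: "('a set \<Rightarrow> nat) \<Rightarrow> 'a set \<Rightarrow> bool" where
  "tight c e \<longleftrightarrow> e \<in> E \<and> minimal c \<and> 2 \<le> seen c e (c e)"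

lemma ex_minimal: "\<exists>c. minimal c"
proof -
  have "colouring (\<lambda>_. 0)" using k_ge by (simp add: colouring_def)
  then show ?thesis
    using ex_has_least_nat[of colouring _ cost] unfolding minimal_def by blast
qed

lemma seen_upd_self: "seen (c(e := j)) e i = seen c e i"
  unfolding seen_def by (rule sum.cong) auto

lemma link_le_seen:
  assumes "F \<subseteq> {f \<in> E - {e}. c f = j}"
  shows "(\<Sum>f\<in>F. link e f) \<le> seen c e j"
  unfolding seen_def using assms finite_E by (intro sum_mono2) auto

lemma sum_seen:
  assumes "colouring c"
  shows "(\<Sum>j<k. seen c e j) = (\<Sum>f\<in>E - {e}. link e f)"
  unfolding seen_def
  by (rule sum.group) (use assms finite_E in \<open>auto simp: colouring_def\<close>)

text \<open>Isolates the influence of \<open>c e\<close>: the double sum does not depend on it, so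
  recoloring \<open>e\<close> changes only the last term.\<close>

lemma cost_split:
  assumes "e \<in> E"
  shows "cost c = (\<Sum>f\<in>E - {e}. \<Sum>g \<in> {g \<in> E - {e} - {f}. c g = c f}. link f g)
                 + 2 * seen c e (c e)"
proof -
  have "seen c f (c f) = (\<Sum>g \<in> {g \<in> E - {e} - {f}. c g = c f}. link f g)
          + (if c f = c e then link e f else 0)" if "f \<in> E - {e}" for f
  proof (cases "c f = c e")
    case True
    then have eq: "{g \<in> E - {f}. c g = c f} = insert e {g \<in> E - {e} - {f}. c g = c f}"
      using assms that by auto
    show ?thesis
      unfolding seen_def eq using True finite_E by (simp add: link_sym[of f e])
  next
    case False
    then have eq: "{g \<in> E - {f}. c g = c f} = {g \<in> E - {e} - {f}. c g = c f}"
      by auto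
    show ?thesis
      unfolding seen_def eq using False by simp
  qed
  then have "(\<Sum>f\<in>E - {e}. seen c f (c f))
      = (\<Sum>f\<in>E - {e}. \<Sum>g \<in> {g \<in> E - {e} - {f}. c g = c f}. link f g)
        + (\<Sum>f\<in>E - {e}. if c f = c e then link e f else 0)"
    by (simp add: sum.distrib)
  moreover have "(\<Sum>f\<in>E - {e}. if c f = c e then link e f else 0) = seen c e (c e)"
    unfolding seen_def using finite_E by (intro sum.inter_filter[symmetric]) auto
  ultimately show ?thesis
    unfolding cost_def using sum.remove[OF finite_E assms, of "\<lambda>e. seen c e (c e)"] by simp
qed

lemma cost_upd:
  assumes "e \<in> E"
  shows "cost (c(e := j)) + 2 * seen c e (c e) = cost c + 2 * seen c e j"
proof -
  have "(\<Sum>f\<in>E - {e}. \<Sum>g \<in> {g \<in> E - {e} - {f}. (c(e := j)) g = (c(e := j)) f}. link f g)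
      = (\<Sum>f\<in>E - {e}. \<Sum>g \<in> {g \<in> E - {e} - {f}. c g = c f}. link f g)"
    by (intro sum.cong) auto
  then show ?thesis
    unfolding cost_split[OF assms] seen_upd_self by simp
qed

lemma colouring_upd: "colouring c \<Longrightarrow> j < k \<Longrightarrow> colouring (c(e := j))"
  by (simp add: colouring_def)

lemma minimal_seen_le:
  assumes "minimal c" "e \<in> E" "j < k"
  shows "seen c e (c e) \<le> seen c e j"
proof -
  have "cost c \<le> cost (c(e := j))"
    using assms colouring_upd unfolding minimal_def by blast
  then show ?thesis using cost_upd[OF assms(2), of c j] by simp
qed

text \<open>The colours are \<^term>\<open>k = D^2 - 1\<close> many and an edge has at most \<^term>\<open>2 * k\<close> links, so an
  edge that sees two links in its best colour sees exactly two in every colour.\<close>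

lemma tight_eq:
  assumes "tight c e"
  shows "\<And>j. j < k \<Longrightarrow> seen c e j = 2" and "\<And>a. a \<in> e \<Longrightarrow> walks a = D^2"
proof -
  have e: "e \<in> E" and m: "minimal c" and two: "2 \<le> seen c e (c e)"
    using assms by (auto simp: tight_def)
  have ge: "2 \<le> seen c e j" if "j < k" for j
    using minimal_seen_le[OF m e that] two by simp
  have tot: "(\<Sum>j<k. seen c e j) + 2 \<le> (\<Sum>a\<in>e. walks a)"
    using sum_seen[of c e] sum_link_others[OF e] m by (simp add: minimal_def)
  have ub: "(\<Sum>a\<in>e. walks a) \<le> 2 * Suc k"
    using sum_walks_le[OF e] k_Suc by simp
  have lb: "2 * k \<le> (\<Sum>j<k. seen c e j)"
    using sum_bounded_below[of "{..<k}" 2 "seen c e"] ge by simp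
  show "seen c e j = 2" if "j < k" for j
  proof (rule ccontr)
    assume "seen c e j \<noteq> 2"
    then have "2 < seen c e j" using ge[OF that] by simp
    then have "(\<Sum>j<k. 2) < (\<Sum>j<k. seen c e j)"
      using that ge by (intro sum_strict_mono_ex1) auto
    then show False using tot ub by simp
  qed
  show "walks a = D^2" if a: "a \<in> e" for a
  proof (rule ccontr)
    assume "walks a \<noteq> D^2"
    then have "walks a < D^2" using walks_le_square[of a] by simp
    then have "(\<Sum>a\<in>e. walks a) < (\<Sum>a\<in>e. D^2)"
      using a walks_le_square finite_edge[OF e] by (intro sum_strict_mono_ex1) auto
    then show False using tot lb edge_card[OF e] k_Suc by simp
  qed
qed

text \<open>A tight edge sees two links in every color, so recoloring it costs nothing. With the
  color of \<open>f\<close> it gives the adjacent \<open>f\<close> two links within its own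
  color.\<close>

lemma tight_shift:
  assumes "tight c e" "f \<in> E" "u \<in> e" "u \<in> f" "e \<noteq> f"
  shows "tight (c(e := c f)) f"
proof -
  let ?c = "c(e := c f)"
  have e: "e \<in> E" and m: "minimal c" using assms by (auto simp: tight_def)
  have cf: "c f < k" using m assms(2) by (simp add: minimal_def colouring_def)
  have ce: "c e < k" using m e by (simp add: minimal_def colouring_def)
  have "cost ?c = cost c"
    using cost_upd[OF e, of c "c f"] tight_eq(1)[OF assms(1)] cf ce by simp
  then have "minimal ?c"
    using m colouring_upd[OF _ cf] by (simp add: minimal_def)
  moreover have "2 \<le> seen ?c f (?c f)"
    using link_le_seen[of "{e}" f ?c "c f"] link_adjacent[OF assms(2) e assms(4,3)] e assms(5)
    by simp
  ultimately show ?thesis using assms(2) by (simp add: tight_def)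
qed

section \<open>Colors around a tight edge\<close>

definition touching :: "'a \<Rightarrow> 'a set set" where
  "touching p = {f \<in> E. f \<inter> nbs p \<noteq> {}}"

text \<open>\<open>f\<close> shares an end with \<open>e\<close> and supplies two links,
  \<open>g\<close> a third, but a tight edge sees only two in any color.\<close>

lemma tight_no_pair:
  assumes "tight c e" "f \<in> E" "g \<in> E" "f \<noteq> e" "g \<noteq> e" "f \<noteq> g" "c f = c g"
    and "x \<in> e" "x \<in> f" "u \<in> e" "z \<in> g" "z \<in> nbs u"
  shows False
proof -
  have e: "e \<in> E" and "c f < k"
    using assms by (auto simp: tight_def minimal_def colouring_def)
  then have "seen c e (c f) = 2" using tight_eq(1)[OF assms(1)] by simp
  moreover have "link e f + link e g \<le> seen c e (c f)"
    using link_le_seen[of "{f, g}" e c "c f"] assms by simp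
  moreover have "2 \<le> link e f" using link_adjacent e assms by blast
  moreover have "1 \<le> link e g" using link_pos e assms by blast
  ultimately show False by simp
qed

text \<open>Two edges of equal color are tested against the edge \<open>h\<close> from
  \<open>u\<close> to \<open>x\<close>. If \<open>h\<close> is one of the three edges,
  \<open>e\<close> itself shares an end with \<open>f\<close> or \<open>g\<close>; otherwise
  tightness is shifted to \<open>h\<close>, which meets \<open>f\<close> in
  \<open>x\<close>.\<close>

lemma tight_inj_on_touching:
  assumes t: "tight c e" and u: "u \<in> e"
  shows "inj_on c (touching u - {e})"
proof (rule inj_onI, rule ccontr)
  fix f g
  assume f: "f \<in> touching u - {e}" and g: "g \<in> touching u - {e}"
    and eq: "c f = c g" and ne: "f \<noteq> g"
  obtain x where x: "x \<in> f" "x \<in> nbs u" using f by (auto simp: touching_def)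
  obtain z where z: "z \<in> g" "z \<in> nbs u" using g by (auto simp: touching_def)
  have fE: "f \<in> E" "f \<noteq> e" and gE: "g \<in> E" "g \<noteq> e"
    using f g by (auto simp: touching_def)
  define h where "h = {u, x}"
  have h: "h \<in> E" "u \<in> h" "x \<in> h" using x(2) by (auto simp: h_def nbs_def)
  consider "h = e" | "h = f" | "h = g" | "h \<noteq> e" "h \<noteq> f" "h \<noteq> g" by blast
  then show False
  proof cases
    case 1
    then show False using tight_no_pair[OF t fE(1) gE(1) fE(2) gE(2) ne eq] h x z u by blast
  next
    case 2
    then show False using tight_no_pair[OF t fE(1) gE(1) fE(2) gE(2) ne eq] h x z u by blast
  next
    case 3
    then show False
      using tight_no_pair[OF t gE(1) fE(1) gE(2) fE(2) ne[symmetric] eq[symmetric]] h x z u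
      by blast
  next
    case 4
    have "tight (c(e := c h)) h"
      using tight_shift[OF t h(1) u h(2)] 4 by blast
    moreover have "(c(e := c h)) f = (c(e := c h)) g" using fE gE eq by simp
    ultimately show False
      using tight_no_pair[OF _ fE(1) gE(1) _ _ ne] 4 h x z by blast
  qed
qed

section \<open>Regularity and absence of triangles\<close>

definition tightable :: "'a set set" where
  "tightable = {e. \<exists>c. tight c e}"

lemma tightable_adjacent:
  assumes "e \<in> tightable" "f \<in> E" "u \<in> e" "u \<in> f"
  shows "f \<in> tightable"
proof (cases "e = f")
  case False
  with assms show ?thesis unfolding tightable_def using tight_shift by blast
qed (use assms in simp)

lemma tightable_edge: "e \<in> tightable \<Longrightarrow> e \<in> E"
  by (auto simp: tightable_def tight_def)

lemma Union_tightable_edge: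
  assumes "u \<in> \<Union>tightable" "u \<in> f" "f \<in> E"
  shows "f \<in> tightable"
  using assms tightable_adjacent by blast

lemma Union_tightable_nbs:
  assumes "u \<in> \<Union>tightable" "v \<in> nbs u"
  shows "v \<in> \<Union>tightable"
  using Union_tightable_edge[OF assms(1), of "{u, v}"] assms(2) by (auto simp: nbs_def)

text \<open>The extremal value \<open>D^2\<close> of \<open>walks u\<close> leaves no room for fewer
  than \<open>D\<close> neighbors.\<close>

lemma tightable_regular:
  assumes "u \<in> \<Union>tightable"
  shows "degree E u = D" and "card (nbs u) = D"
proof -
  have "walks u = D^2" using assms tight_eq(2) by (auto simp: tightable_def)
  then have "D * D \<le> degree E u * D"
    using walks_le[of u] by (simp add: power2_eq_square card_nbs)
  then show "degree E u = D" using D_ge_3 degree_le[of u] by simp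
  then show "card (nbs u) = D" by (simp add: card_nbs)
qed

text \<open>Two edges of a triangle have three links, more than a tight edge sees in one
  color.\<close>

lemma tightable_no_triangle:
  assumes "u \<in> \<Union>tightable" "v \<in> nbs u" "w \<in> nbs u" "w \<in> nbs v"
  shows False
proof -
  have E: "{u, v} \<in> E" "{v, w} \<in> E" "{u, w} \<in> E" using assms(2-4) by (auto simp: nbs_def)
  then have "{u, v} \<in> tightable" using Union_tightable_edge[OF assms(1)] by blast
  then obtain c where c: "tight c {u, v}" by (auto simp: tightable_def)
  have "c {v, w} < k" using c E by (auto simp: tight_def minimal_def colouring_def)
  then have "seen c {u, v} (c {v, w}) = 2" using tight_eq(1)[OF c] by simp
  moreover have "{v, w} \<noteq> {u, v}" using no_loop[OF E(3)] no_loop[OF E(2)] by (auto simp: doubleton_eq_iff)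
  then have "link {u, v} {v, w} \<le> seen c {u, v} (c {v, w})"
    using link_le_seen[of "{{v, w}}" "{u, v}" c] E by simp
  ultimately show False using link_triangle[OF E] by simp
qed

lemma touching_Int_nbs:
  assumes "p \<in> \<Union>tightable" "f \<in> touching p"
  obtains t where "f \<inter> nbs p = {t}"
proof -
  obtain t where t: "t \<in> f" "t \<in> nbs p" using assms(2) by (auto simp: touching_def)
  have "f \<in> E" using assms(2) by (simp add: touching_def)
  then obtain s where s: "f = {t, s}" using edge_other_end t(1) by metis
  have "s \<in> nbs t" using s \<open>f \<in> E\<close> by (simp add: nbs_def)
  then have "s \<notin> nbs p" using tightable_no_triangle[OF assms(1) t(2)] by blast
  then have "f \<inter> nbs p = {t}" using s t by auto
  then show ?thesis by (rule that)
qed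

text \<open>The stars at the neighbors of \<open>p\<close> are disjoint, since an edge in two of
  them would close a triangle with \<open>p\<close>.\<close>

lemma card_touching:
  assumes "p \<in> \<Union>tightable"
  shows "card (touching p) = D^2"
proof -
  have "touching p = (\<Union>t\<in>nbs p. {f\<in>E. t \<in> f})"
    by (auto simp: touching_def)
  also have "card \<dots> = (\<Sum>t\<in>nbs p. card {f\<in>E. t \<in> f})"
  proof (rule card_UN_disjoint)
    show "\<forall>t\<in>nbs p. \<forall>s\<in>nbs p. t \<noteq> s \<longrightarrow> {f\<in>E. t \<in> f} \<inter> {f\<in>E. s \<in> f} = {}"
    proof (intro ballI impI equals0I)
      fix t s f
      assume *: "t \<in> nbs p" "s \<in> nbs p" "t \<noteq> s" "f \<in> {f\<in>E. t \<in> f} \<inter> {f\<in>E. s \<in> f}"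
      then have "f \<in> touching p" by (auto simp: touching_def)
      then obtain r where "f \<inter> nbs p = {r}" using touching_Int_nbs[OF assms] by blast
      moreover have "t \<in> f \<inter> nbs p" "s \<in> f \<inter> nbs p" using *(1,2,4) by auto
      ultimately show False using *(3) by simp
    qed
  qed (use finite_nbs finite_E in auto)
  also have "\<dots> = (\<Sum>t\<in>nbs p. D)"
    using tightable_regular(1)[OF Union_tightable_nbs[OF assms]]
    by (intro sum.cong) (auto simp: degree_def)
  also have "\<dots> = D^2"
    using tightable_regular(2)[OF assms] by (simp add: power2_eq_square)
  finally show ?thesis .
qed

section \<open>Regions avoiding a neighborhood\<close>

text \<open>Only the edge being left must avoid \<open>touching p\<close>. A walk may thus enter
  \<open>touching p\<close>, but it ends there, so a region contains its entry edges.\<close>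

definition step_avoiding :: "'a \<Rightarrow> 'a set \<Rightarrow> 'a set \<Rightarrow> bool" where
  "step_avoiding p f g \<longleftrightarrow> g \<in> E \<and> f \<inter> g \<noteq> {} \<and> f \<notin> touching p"

definition region :: "'a \<Rightarrow> 'a set \<Rightarrow> 'a set set" where
  "region p e = {f. (step_avoiding p)\<^sup>*\<^sup>* e f}"

lemma region_step:
  "f \<in> region p e \<Longrightarrow> f \<notin> touching p \<Longrightarrow> g \<in> E \<Longrightarrow> u \<in> f \<Longrightarrow> u \<in> g \<Longrightarrow> g \<in> region p e"
  unfolding region_def step_avoiding_def by (auto intro: rtranclp.rtrancl_into_rtrancl)

lemma region_edge: "e \<in> E \<Longrightarrow> f \<in> region p e \<Longrightarrow> f \<in> E"
  unfolding region_def by (auto elim: rtranclp.cases simp: step_avoiding_def)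

text \<open>A shift recolors only the edge it leaves, and that edge lies outside
  \<open>touching p\<close>.\<close>

lemma tight_region:
  assumes "tight c e" "f \<in> region p e"
  shows "\<exists>c'. tight c' f \<and> (\<forall>g\<in>touching p. c' g = c g)"
proof -
  have "(step_avoiding p)\<^sup>*\<^sup>* e f" using assms(2) by (simp add: region_def)
  then show ?thesis
  proof induction
    case base
    then show ?case using assms(1) by blast
  next
    case (step f g)
    then obtain c' where c': "tight c' f" "\<forall>g\<in>touching p. c' g = c g" by blast
    show ?case
    proof (cases "f = g")
      case False
      obtain u where "u \<in> f" "u \<in> g" using step.hyps(2) by (auto simp: step_avoiding_def)
      then have "tight (c'(f := c' g)) g"
        using tight_shift[OF c'(1)] False step.hyps(2) by (auto simp: step_avoiding_def)
      moreover have "\<forall>h\<in>touching p. (c'(f := c' g)) h = c h"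
        using c'(2) step.hyps(2) by (auto simp: step_avoiding_def)
      ultimately show ?thesis by blast
    qed (use c' in blast)
  qed
qed

text \<open>Tightness can be moved to \<open>f\<close> without altering colors on
  \<open>touching p\<close>. If \<open>f\<close> does not contain \<open>p\<close>, one more shift
  leads to an edge at \<open>p\<close>, where injectivity is known.\<close>

lemma inj_on_touching_entry:
  assumes "tight c e" "f \<in> region p e" "f \<in> touching p"
  shows "inj_on c (touching p - {f})"
proof -
  obtain c' where c': "tight c' f" "\<forall>g\<in>touching p. c' g = c g"
    using tight_region[OF assms(1,2)] by blast
  have "inj_on c' (touching p - {f})"
  proof (cases "p \<in> f")
    case True
    then show ?thesis using tight_inj_on_touching[OF c'(1)] by blast
  next
    case False
    obtain t where t: "t \<in> f" "t \<in> nbs p" using assms(3) by (auto simp: touching_def)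
    define h where "h = {t, p}"
    have h: "h \<in> E" "t \<in> h" "p \<in> h" "f \<noteq> h" "h \<in> touching p"
      using t(2) False by (auto simp: h_def nbs_def touching_def insert_commute)
    have "tight (c'(f := c' h)) h"
      using tight_shift[OF c'(1) h(1) t(1) h(2,4)] .
    then have inj: "inj_on (c'(f := c' h)) (touching p - {h})"
      using tight_inj_on_touching h(3) by blast
    \<comment> \<open>After the shift \<open>f\<close> carries the color that \<open>h\<close> has
      under \<open>c'\<close>, so \<open>f\<close> stands in for \<open>h\<close> when
      \<open>x = h\<close>.\<close>
    have eq: "x = y"
      if xy: "x \<in> touching p - {f}" "y \<in> touching p - {f}" "c' x = c' y" "y \<noteq> h" for x y
    proof (cases "x = h")
      case True
      then have "(c'(f := c' h)) f = (c'(f := c' h)) y" using xy by simp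
      then have "f = y" by (rule inj_onD[OF inj]) (use xy h(4) assms(3) in blast)+
      then show ?thesis using xy(2) by simp
    next
      case False
      have "(c'(f := c' h)) x = (c'(f := c' h)) y" using xy by simp
      then show ?thesis by (rule inj_onD[OF inj]) (use xy False in blast)+
    qed
    show ?thesis by (rule inj_onI) (metis eq)
  qed
  then show ?thesis using c'(2) by (auto simp: inj_on_def)
qed

text \<open>\<^term>\<open>touching p\<close> has one edge more than there are colours. A monochromatic pair in it must be
  hit by every edge through which a tight edge can be shifted into \<^term>\<open>touching p\<close>.\<close>

lemma ex_unentered_nb:
  assumes "e \<in> tightable" "p \<in> \<Union>tightable"
  obtains t where "t \<in> nbs p" "\<And>f. f \<in> region p e \<Longrightarrow> f \<in> touching p \<Longrightarrow> t \<notin> f"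
proof -
  obtain c where c: "tight c e" using assms(1) by (auto simp: tightable_def)
  have "c ` touching p \<subseteq> {..<k}"
    using c by (auto simp: tight_def minimal_def colouring_def touching_def)
  then have "card (c ` touching p) \<le> k"
    using card_mono[of "{..<k}"] by fastforce
  then have "\<not> inj_on c (touching p)"
    using card_image[of c "touching p"] card_touching[OF assms(2)] k_Suc by auto
  then obtain a b where ab: "a \<in> touching p" "b \<in> touching p" "a \<noteq> b" "c a = c b"
    by (auto simp: inj_on_def)
  have entry: "f = a \<or> f = b" if "f \<in> region p e" "f \<in> touching p" for f
    using inj_onD[OF inj_on_touching_entry[OF c that] ab(4)] ab by blast
  obtain s where s: "a \<inter> nbs p = {s}" using touching_Int_nbs[OF assms(2) ab(1)] .
  obtain r where r: "b \<inter> nbs p = {r}" using touching_Int_nbs[OF assms(2) ab(2)] .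
  have "\<not> nbs p \<subseteq> {s, r}"
  proof
    assume "nbs p \<subseteq> {s, r}"
    then have "card (nbs p) \<le> card {s, r}" by (intro card_mono) auto
    also have "\<dots> \<le> 2" by (simp add: card_insert_if)
    finally show False using tightable_regular(2)[OF assms(2)] D_ge_3 by simp
  qed
  then obtain t where "t \<in> nbs p" "t \<noteq> s" "t \<noteq> r" by blast
  then show ?thesis using that entry s r by blast
qed

section \<open>Components of tightable edges are complete bipartite\<close>

context
  fixes C :: "'a set"
  assumes C_tightable: "C \<subseteq> \<Union>tightable"
    and C_closed: "\<And>x y. x \<in> C \<Longrightarrow> y \<in> nbs x \<Longrightarrow> y \<in> C"
    and C_connected: "\<And>U x y. \<lbrakk>\<And>a b. {a, b} \<in> E \<Longrightarrow> a \<in> U \<Longrightarrow> b \<in> U; x \<in> C; y \<in> C; x \<in> U\<rbrakk> \<Longrightarrow> y \<in> U"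
begin

text \<open>A region without entry edges would be closed under adjacency and so reach
  \<open>p\<close>, yet every edge at \<open>p\<close> lies in \<open>touching p\<close>.\<close>

lemma ex_entry:
  assumes "p \<in> C" "e \<in> E" "e \<subseteq> C"
  shows "region p e \<inter> touching p \<noteq> {}"
proof
  assume none: "region p e \<inter> touching p = {}"
  define U where "U = \<Union>(region p e)"
  have closed: "b \<in> U" if "{a, b} \<in> E" "a \<in> U" for a b
    using that region_step[of _ p e "{a, b}" a] none by (auto simp: U_def)
  obtain x where x: "x \<in> e" using edge_card[OF assms(2)] by fastforce
  moreover have "e \<in> region p e" by (simp add: region_def)
  ultimately have "x \<in> U" by (auto simp: U_def)
  then have "p \<in> U" using closed x assms(1,3) by (intro C_connected[of U x p]) auto
  then obtain f where f: "f \<in> region p e" "p \<in> f" by (auto simp: U_def)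
  then have "f \<in> E" using region_edge assms(2) by blast
  then obtain t where "f = {p, t}" using edge_other_end f(2) by metis
  then have "f \<in> touching p" using \<open>f \<in> E\<close> by (auto simp: touching_def nbs_def)
  then show False using none f(1) by blast
qed

text \<open>The new center \<open>t\<close> is a neighbor of \<open>p\<close> that no entry edge
  contains.\<close>

lemma larger_region:
  assumes p: "p \<in> C" and e: "e \<in> E" "e \<subseteq> C" "e \<notin> touching p"
  obtains t where "t \<in> C" "e \<notin> touching t" "region p e - touching p \<subset> region t e - touching t"
proof -
  have pT: "p \<in> \<Union>tightable" using p C_tightable by blast
  have "e \<in> tightable"
    using e C_tightable edge_card[OF e(1)] Union_tightable_edge
    by (metis Union_iff card_2_iff' subsetD)
  then obtain t where t: "t \<in> nbs p" and unentered: "\<And>f. f \<in> region p e \<Longrightarrow> f \<in> touching p \<Longrightarrow> t \<notin> f"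
    using ex_unentered_nb pT by metis
  \<comment> \<open>Otherwise the edge from \<open>f\<close> to \<open>t\<close> would itself be an
    entry edge containing \<open>t\<close>.\<close>
  have avoid: "f \<notin> touching t" if f: "f \<in> region p e" "f \<notin> touching p" for f
  proof
    assume "f \<in> touching t"
    then obtain s where s: "s \<in> f" "s \<in> nbs t" by (auto simp: touching_def)
    then have st: "{s, t} \<in> E" by (auto simp: nbs_def insert_commute)
    then have "{s, t} \<in> region p e" using region_step[OF f] s(1) by blast
    moreover have "{s, t} \<in> touching p" using st t by (auto simp: touching_def)
    ultimately show False using unentered by blast
  qed
  have sub: "f \<in> region t e" if "f \<in> region p e" for f
  proof -
    have "(step_avoiding p)\<^sup>*\<^sup>* e f" using that by (simp add: region_def)
    then show ?thesis
    proof induction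
      case (step f g)
      have "f \<notin> touching t"
        using avoid step.hyps by (simp add: region_def step_avoiding_def)
      then show ?case
        using region_step[OF step.IH] step.hyps(2) by (auto simp: step_avoiding_def)
    qed (simp add: region_def)
  qed
  \<comment> \<open>An entry edge \<open>f\<close> makes the inclusion strict. As \<open>e\<close>
    avoids \<open>touching p\<close>, \<open>f\<close> has a predecessor \<open>f'\<close>. The end
    \<open>s\<close> shared with \<open>f'\<close> is not adjacent to \<open>t\<close> by
    \<open>avoid\<close>; the end \<open>r\<close> is not, as \<open>p\<close>, \<open>t\<close>,
    \<open>r\<close> would form a triangle.\<close>
  obtain f where f: "f \<in> region p e" "f \<in> touching p" using ex_entry[OF p e(1,2)] by blast
  have "(step_avoiding p)\<^sup>*\<^sup>* e f" using f(1) by (simp add: region_def)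
  then obtain f' where f': "(step_avoiding p)\<^sup>*\<^sup>* e f'" "step_avoiding p f' f"
    using f(2) e(3) by (metis rtranclp.cases)
  obtain s where s: "s \<in> f'" "s \<in> f" using f'(2) by (auto simp: step_avoiding_def)
  have fE: "f \<in> E" and f'_out: "f' \<in> region p e" "f' \<notin> touching p"
    using f' by (auto simp: step_avoiding_def region_def)
  then have f'E: "f' \<in> E" using region_edge e(1) by blast
  obtain r where r: "f \<inter> nbs p = {r}" using touching_Int_nbs[OF pT f(2)] .
  have "s \<notin> nbs p" using s(1) f'_out(2) f'E by (auto simp: touching_def)
  then have f_eq: "f = {s, r}" using edge_other_end[OF fE s(2)] r by (metis Int_iff insertE singletonD singletonI)
  have "s \<notin> nbs t" using avoid[OF f'_out] s(1) f'E by (auto simp: touching_def)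
  moreover have "r \<notin> nbs t" using tightable_no_triangle[OF pT t] r by blast
  ultimately have "f \<notin> touching t" using f_eq by (auto simp: touching_def)
  then have "region p e - touching p \<subset> region t e - touching t"
    using f sub avoid by blast
  moreover have "e \<notin> touching t" using avoid[of e] e(3) by (simp add: region_def)
  moreover have "t \<in> C" using C_closed p t by blast
  ultimately show ?thesis using that by blast
qed

lemma every_edge_touches:
  assumes "p \<in> C" "e \<in> E" "e \<subseteq> C"
  shows "e \<in> touching p"
proof (rule ccontr)
  assume "e \<notin> touching p"
  with assms(1) show False
  \<comment> \<open>The regions grow strictly within the finite set \<open>E\<close>, so the
    replacement of centers must stop.\<close>
  proof (induction "card E - card (region p e - touching p)" arbitrary: p rule: less_induct)
    case less
    obtain t where t: "t \<in> C" "e \<notin> touching t"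
      "region p e - touching p \<subset> region t e - touching t"
      using larger_region[OF less.prems(1) assms(2,3) less.prems(2)] by blast
    have "region t e - touching t \<subseteq> E" using region_edge assms(2) by blast
    then have "card (region t e - touching t) \<le> card E" "finite (region t e - touching t)"
      using card_mono[OF finite_E] finite_subset[OF _ finite_E] by auto
    moreover have "card (region p e - touching p) < card (region t e - touching t)"
      using t(3) calculation(2) by (rule psubset_card_mono[rotated])
    ultimately show False using less.hyps[OF _ t(1,2)] by linarith
  qed
qed

lemma complete_bipartite:
  assumes p: "p \<in> C" and CV: "C \<subseteq> V"
  shows "iso_complete_bipartite C (induced_edges E C) D"
proof -
  define A where "A = nbs p"
  define B where "B = C - A"
  have AC: "A \<subseteq> C" using C_closed p by (auto simp: A_def)
  have reg: "card (nbs x) = D" if "x \<in> C" for x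
    using that C_tightable tightable_regular(2) by blast
  \<comment> \<open>An edge at \<open>b\<close> touches \<open>p\<close> but not in
    \<open>b\<close>, so its other end is in \<open>A\<close>; regularity turns the inclusion into
    equality.\<close>
  have B_nbs: "nbs b = A" if b: "b \<in> B" for b
  proof (rule card_subset_eq)
    show "nbs b \<subseteq> A"
    proof
      fix x assume x: "x \<in> nbs b"
      then have "x \<in> C" using b C_closed by (auto simp: B_def)
      moreover have "b \<in> C" "b \<notin> A" using b by (simp_all add: B_def)
      ultimately have "{b, x} \<in> touching p"
        using every_edge_touches[OF p, of "{b, x}"] x by (simp add: nbs_def)
      then show "x \<in> A" using \<open>b \<notin> A\<close> by (simp add: touching_def A_def split: if_splits)
    qed
    show "card (nbs b) = card A" using reg b p by (simp add: A_def B_def)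
  qed (simp add: A_def finite_nbs)
  have A_nbs: "nbs a = B" if a: "a \<in> A" for a
  proof
    show "B \<subseteq> nbs a"
    proof
      fix b assume "b \<in> B"
      then have "a \<in> nbs b" using B_nbs a by simp
      then show "b \<in> nbs a" by (simp add: nbs_sym[of b])
    qed
    show "nbs a \<subseteq> B"
    proof
      fix x assume x: "x \<in> nbs a"
      have "p \<in> \<Union>tightable" using p C_tightable by (rule subsetD[rotated])
      then have "x \<notin> A" using tightable_no_triangle a x unfolding A_def by metis
      moreover have "x \<in> C" using C_closed AC a x by (metis subsetD)
      ultimately show "x \<in> B" by (simp add: B_def)
    qed
  qed
  have "card A = D" using reg p by (simp add: A_def)
  then obtain a where "a \<in> A" using D_ge_3 by fastforce
  then have "card B = D" using A_nbs[of a] reg[of a] AC by auto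
  moreover have "induced_edges E C = {{a, b} | a b. a \<in> A \<and> b \<in> B}"
  proof (intro equalityI subsetI)
    fix e assume "e \<in> induced_edges E C"
    then have e: "e \<in> E" "e \<subseteq> C" by (auto simp: induced_edges_def)
    obtain a where a: "a \<in> e" "a \<in> A"
      using every_edge_touches[OF p e] by (auto simp: touching_def A_def)
    obtain b where b: "e = {a, b}" using edge_other_end[OF e(1) a(1)] .
    then have "b \<in> nbs a" using e(1) by (simp add: nbs_def)
    then have "b \<in> B" using A_nbs[OF a(2)] by simp
    then show "e \<in> {{a, b} | a b. a \<in> A \<and> b \<in> B}" using a(2) b by auto
  next
    fix e assume "e \<in> {{a, b} | a b. a \<in> A \<and> b \<in> B}"
    then obtain a b where ab: "e = {a, b}" "a \<in> A" "b \<in> B" by auto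
    moreover have "b \<in> nbs a" using ab A_nbs by simp
    ultimately show "e \<in> induced_edges E C"
      using AC by (auto simp: induced_edges_def nbs_def B_def)
  qed
  ultimately show ?thesis
    unfolding iso_complete_bipartite_def using \<open>card A = D\<close> AC
    by (intro exI[of _ A] exI[of _ B]) (auto simp: B_def)
qed

end

lemma tightable_component:
  assumes "e \<in> tightable"
  shows "\<exists>C\<in>components V E. iso_complete_bipartite C (induced_edges E C) D"
proof -
  have e: "e \<in> E" using assms tightable_edge by blast
  then obtain p where p: "p \<in> e" using edge_card by fastforce
  have pV: "p \<in> V" using e p edge_subset by blast
  define C where "C = {w\<in>V. reachable E p w}"
  have "C \<in> components V E" using pV by (auto simp: components_def C_def)
  moreover have "iso_complete_bipartite C (induced_edges E C) D"
  proof (rule complete_bipartite)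
    show "p \<in> C" using pV by (simp add: C_def reachable.refl)
    show "C \<subseteq> V" by (auto simp: C_def)
    show "C \<subseteq> \<Union>tightable"
    proof
      fix w assume "w \<in> C"
      then have "reachable E p w" by (simp add: C_def)
      then have "p \<in> \<Union>tightable \<longleftrightarrow> w \<in> \<Union>tightable"
        by (rule reachable_closed_set) (use Union_tightable_nbs in \<open>auto simp: nbs_def\<close>)
      then show "w \<in> \<Union>tightable" using assms p by blast
    qed
    show "y \<in> C" if "x \<in> C" "y \<in> nbs x" for x y
      using that nbs_subset reachable.step by (fastforce simp: C_def nbs_def)
    show "y \<in> U" if "\<And>a b. {a, b} \<in> E \<Longrightarrow> a \<in> U \<Longrightarrow> b \<in> U" "x \<in> C" "y \<in> C" "x \<in> U"
      for U x y
    proof -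
      have "p \<in> U \<longleftrightarrow> z \<in> U" if "z \<in> C" for z
        using that \<open>\<And>a b. {a, b} \<in> E \<Longrightarrow> a \<in> U \<Longrightarrow> b \<in> U\<close>
        by (intro reachable_closed_set) (auto simp: C_def)
      then show ?thesis using that(2-4) by blast
    qed
  qed
  ultimately show ?thesis by blast
qed

section \<open>From minimal colorings to semistrong matchings\<close>

text \<open>If neither end of \<open>e\<close> had degree 1 in the graph induced by its class, each
  would be adjacent to an end of another edge of the class, giving two links.\<close>

lemma semistrong_if_not_tight:
  assumes "\<And>e. e \<in> E \<Longrightarrow> seen c e (c e) \<le> 1"
  shows "semistrong_matching E {e\<in>E. c e = i}"
  unfolding semistrong_matching_def
proof (intro conjI ballI)
  define M where "M = {e\<in>E. c e = i}"
  fix e assume "e \<in> {e\<in>E. c e = i}"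
  then have e: "e \<in> E" "c e = i" by auto
  obtain u where "u \<in> e" using edge_card[OF e(1)] by fastforce
  then obtain v where uv: "e = {u, v}" "u \<noteq> v" using edge_other_end e(1) by metis
  \<comment> \<open>The far end of any induced edge at \<open>a\<close> is covered by the class;
    only \<open>e\<close> can cover it, so that edge is \<open>e\<close>.\<close>
  have degree_1: "degree (induced_edges E (\<Union>M)) a = 1"
    if a: "a \<in> e" and "\<And>f b. f \<in> M - {e} \<Longrightarrow> b \<in> f \<Longrightarrow> b \<notin> nbs a" for a
  proof -
    have "{g \<in> induced_edges E (\<Union>M). a \<in> g} = {e}"
    proof (intro equalityI subsetI)
      fix g assume "g \<in> {g \<in> induced_edges E (\<Union>M). a \<in> g}"
      then have g: "g \<in> E" "g \<subseteq> \<Union>M" "a \<in> g" by (auto simp: induced_edges_def)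
      then obtain b where b: "g = {a, b}" "a \<noteq> b" using edge_other_end by metis
      then obtain f where "f \<in> M" "b \<in> f" using g(2) by blast
      moreover have "b \<in> nbs a" using b g(1) by (simp add: nbs_def)
      ultimately have "b \<in> e" using that(2) by blast
      moreover obtain a' where "e = {a, a'}" using edge_other_end[OF e(1) a] .
      ultimately show "g \<in> {e}" using b by auto
    qed (use e a in \<open>auto simp: induced_edges_def M_def\<close>)
    then show ?thesis by (simp add: degree_def)
  qed
  show "\<exists>v\<in>e. degree (induced_edges E (\<Union>{e\<in>E. c e = i})) v = 1"
  proof (rule ccontr)
    assume none: "\<not> ?thesis"
    have ex: "\<exists>f b. f \<in> M - {e} \<and> b \<in> f \<and> b \<in> nbs a" if "a \<in> e" for a
      using degree_1[OF that] none that by (auto simp: M_def)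
    obtain f x where f: "f \<in> M - {e}" "x \<in> f" "x \<in> nbs u" using ex uv by blast
    obtain g y where g: "g \<in> M - {e}" "y \<in> g" "y \<in> nbs v" using ex uv by blast
    have fE: "f \<in> E" and gE: "g \<in> E" using f g by (auto simp: M_def)
    have "2 \<le> seen c e (c e)"
    \<comment> \<open>One edge may serve both ends of \<open>e\<close>; its two links still differ,
      since they start at different ends.\<close>
    proof (cases "f = g")
      case True
      have "card {(u, x), (v, y)} \<le> link e f"
        using f g True uv fE e by (intro card_le_link) (auto simp: nbs_def)
      then have "2 \<le> link e f" using uv(2) by simp
      also have "link e f \<le> seen c e (c e)"
        using link_le_seen[of "{f}" e c "c e"] f e by (simp add: M_def)
      finally show ?thesis .
    next
      case False
      have "link e f + link e g \<le> seen c e (c e)"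
        using link_le_seen[of "{f, g}" e c "c e"] f g e False by (simp add: M_def)
      moreover have "1 \<le> link e f" using link_pos[OF e(1) fE] f uv by blast
      moreover have "1 \<le> link e g" using link_pos[OF e(1) gE] g uv by blast
      ultimately show ?thesis by simp
    qed
    then show False using assms[OF e(1)] by simp
  qed
qed auto

lemma ex_semistrong_coloring:
  assumes "\<forall>C\<in>components V E. \<not> iso_complete_bipartite C (induced_edges E C) D"
  shows "\<exists>c. semistrong_coloring E (D^2 - 1) c"
proof -
  obtain c where c: "minimal c" using ex_minimal by blast
  have "\<not> tight c e" for e
    using tightable_component[of e] assms by (auto simp: tightable_def)
  then have "seen c e (c e) \<le> 1" if "e \<in> E" for e
    using c that by (fastforce simp: tight_def)
  then show ?thesis
    using semistrong_if_not_tight c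
    by (auto simp: semistrong_coloring_def minimal_def colouring_def k_def intro!: exI[of _ c])
qed

end

theorem theorem2:
  fixes V :: "'a set" and E :: "'a set set"
  assumes "simple_graph V E"
    and "max_degree V E \<ge> 3"
    and "\<forall>C\<in>components V E.
           \<not> iso_complete_bipartite C (induced_edges E C) (max_degree V E)"
  shows "semistrong_chromatic_index E \<le> (max_degree V E)^2 - 1"
proof -
  interpret bounded_graph V E "max_degree V E"
  proof
    show "degree E v \<le> max_degree V E" if "v \<in> V" for v
      using that assms(1) by (simp add: max_degree_def simple_graph_def)
  qed (use assms in auto)
  show ?thesis
    unfolding semistrong_chromatic_index_def
    by (rule Least_le) (rule ex_semistrong_coloring[OF assms(3)])
qed

end
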